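(* Let $Y$ be a real random variable whose moment generating function exists in a neighborhood of the origin and such that $E[Y]\neq 0$. Then the following hold. (a) For all integers $n,l\ge 0$, $$\sum_{k=l}^{n} S_{2}^{Y}(n,k)S_{1}^{Y}(k,l)=\delta_{n,l},\qquad \sum_{k=l}^{n} S_{1}^{Y}(n,k)S_{2}^{Y}(k,l)=\delta_{n,l}.$$ (b) For any sequences $(a_n)_{n\ge 0}$, $(b_n)_{n\ge 0}$ of complex numbers, $$a_{n}=\sum_{k=0}^{n}S_{2}^{Y}(n,k) b_{k}\ \text{ for all } n\ge 0 \iff b_{n}=\sum_{k=0}^{n}S_{1}^{Y}(n,k)a_{k}\ \text{ for all } n\ge 0.$$ (c) For any integer $m\ge 0$ and any complex numbers $a_0,\dots,a_m,b_0,\dots,b_m$, $$a_{n}=\sum_{k=n}^{m}S_{2}^{Y}(k,n)b_{k}\ \text{ for all } 0\le n\le m \iff b_{n}=\sum_{k=n}^{m}S_{1}^{Y}(k,n)a_{k}\ \text{ for all } 0\le n\le m.$$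
   Context: Existence of the moment generating function near the origin means that for some $r>0$, $E[e^{Yt}]=\sum_{n\ge 0}E[Y^n]\frac{t^n}{n!}$ exists for $|t|<r$. Put $e_Y(t)=E[e^{Yt}]-1=\sum_{n\ge 1}E[Y^n]\frac{t^n}{n!}$; since $E[Y]\ne 0$, this power series has zero constant term and nonzero linear coefficient, so it has a compositional inverse $\bar e_Y(t)$, i.e. $e_Y(\bar e_Y(t))=\bar e_Y(e_Y(t))=t$. The probabilistic Stirling numbers of the second kind $S_2^Y(n,k)$ and of the first kind $S_1^Y(n,k)$ associated with $Y$ are defined, for $k\ge 0$, by $$\frac{1}{k!}\big(e_Y(t)\big)^k=\sum_{n=k}^\infty S_2^Y(n,k)\frac{t^n}{n!},\qquad \frac{1}{k!}\big(\bar e_Y(t)\big)^k=\sum_{n=k}^\infty S_1^Y(n,k)\frac{t^n}{n!},$$ and $S_2^Y(n,k)=S_1^Y(n,k)=0$ if $k>n$ or $k<0$. $\delta_{n,l}$ is the Kronecker delta; empty sums are $0$. *)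

theory Defs
  imports
    "HOL-Probability.Probability"
    "HOL-Computational_Algebra.Formal_Power_Series"
begin

unbundle no vec_syntax and fps_syntax

text \<open>
  The moment generating function exists in a neighbourhood of the origin: for some \<open>r > 0\<close>, the
  expectation of \<open>exp (t Y)\<close> is finite whenever \<open>\<bar>t\<bar> < r\<close>.
\<close>

definition mgf_exists_near_0 :: "'a measure \<Rightarrow> ('a \<Rightarrow> real) \<Rightarrow> bool" where
  "mgf_exists_near_0 M Y \<longleftrightarrow>
     (\<exists>r>0. \<forall>t. \<bar>t\<bar> < r \<longrightarrow> integrable M (\<lambda>x. exp (t * Y x)))"

text \<open>
  The power series of \<open>e\<^sub>Y(t) = E[exp (t Y)] - 1\<close> at the origin; lemma \<open>egf_sums_mgf\<close> below shows that
  it converges to this function near the origin.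
\<close>

definition egf :: "'a measure \<Rightarrow> ('a \<Rightarrow> real) \<Rightarrow> real fps" where
  "egf M Y = Abs_fps (\<lambda>n. integral\<^sup>L M (\<lambda>x. Y x ^ n) / fact n) - 1"

text \<open>
  Both kinds of Stirling numbers are \<open>n!\<close> times the coefficients of \<open>t^n\<close> in the power series
  \<open>e\<^sub>Y(t)^k / k!\<close>, respectively in the same expression for the compositional inverse of \<open>e\<^sub>Y\<close>. They
  vanish for \<open>k > n\<close> because the base series have no constant term (lemmas \<open>stirling2_Y_eq_0\<close> and
  \<open>stirling1_Y_eq_0\<close>).
\<close>

definition stirling2_Y :: "'a measure \<Rightarrow> ('a \<Rightarrow> real) \<Rightarrow> nat \<Rightarrow> nat \<Rightarrow> real" where
  "stirling2_Y M Y n k = fact n * ((fps_const (1 / fact k) * egf M Y ^ k) $ n)"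

definition stirling1_Y :: "'a measure \<Rightarrow> ('a \<Rightarrow> real) \<Rightarrow> nat \<Rightarrow> nat \<Rightarrow> real" where
  "stirling1_Y M Y n k = fact n * ((fps_const (1 / fact k) * fps_inv (egf M Y) ^ k) $ n)"

lemma (in prob_space) egf_nth_0: "egf M Y $ 0 = 0"
  by (simp add: egf_def prob_space)

lemma egf_nth_1: "egf M Y $ 1 = integral\<^sup>L M Y"
  by (simp add: egf_def)

lemma (in prob_space) egf_compositional_inverse:
  assumes "expectation Y \<noteq> 0"
  shows "egf M Y oo fps_inv (egf M Y) = fps_X" "fps_inv (egf M Y) oo egf M Y = fps_X"
  using assms by (simp_all add: fps_inv fps_inv_right egf_nth_0 egf_nth_1[unfolded One_nat_def])

lemma (in prob_space) stirling2_Y_eq_0: "n < k \<Longrightarrow> stirling2_Y M Y n k = 0"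
  using startsby_zero_power_prefix[of "egf M Y" k] by (simp add: stirling2_Y_def egf_nth_0)

lemma stirling1_Y_eq_0: "n < k \<Longrightarrow> stirling1_Y M Y n k = 0"
  using startsby_zero_power_prefix[of "fps_inv (egf M Y)" k]
  by (simp add: stirling1_Y_def fps_inv_def)

lemma (in prob_space) egf_sums_mgf:
  assumes Y [measurable]: "Y \<in> borel_measurable M"
    and mgf: "\<And>t. \<bar>t\<bar> < r \<Longrightarrow> integrable M (\<lambda>x. exp (t * Y x))"
    and t: "\<bar>t\<bar> < r"
  shows "(\<lambda>n. egf M Y $ n * t ^ n) sums (expectation (\<lambda>x. exp (t * Y x)) - 1)"
proof -
  have int_abs: "integrable M (\<lambda>x. exp (s * \<bar>Y x\<bar>))" if "\<bar>s\<bar> < r" for s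
  proof (rule Bochner_Integration.integrable_bound)
    show "integrable M (\<lambda>x. exp (s * Y x) + exp ((- s) * Y x))"
      using that by (intro Bochner_Integration.integrable_add mgf) auto
    have "exp (s * \<bar>y\<bar>) \<le> exp (s * y) + exp (- s * y)" for y :: real
      by (simp add: abs_if)
    then show "AE x in M. norm (exp (s * \<bar>Y x\<bar>)) \<le> norm (exp (s * Y x) + exp ((- s) * Y x))"
      by (intro AE_I2) (simp add: order_trans[OF _ abs_ge_self])
  qed simp
  have part: "(\<Sum>i<n. \<bar>y\<bar> ^ i / fact i) \<le> exp \<bar>y\<bar>" for y :: real and n
    unfolding exp_def
    using sum_le_suminf[OF summable_exp, of "{..<n}" "\<bar>y\<bar>"]
    by (simp add: divide_inverse scaleR_conv_of_real mult.commute)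
  define s where "s = (\<bar>t\<bar> + r) / 2"
  have s: "0 < s" "\<bar>s\<bar> < r" using t by (auto simp: s_def)
  have moments: "integrable M (\<lambda>x. Y x ^ n)" for n
  proof (rule Bochner_Integration.integrable_bound)
    show "integrable M (\<lambda>x. fact n / s ^ n * exp (s * \<bar>Y x\<bar>))"
      using int_abs[OF s(2)] by simp
    have "\<bar>Y x\<bar> ^ n \<le> fact n / s ^ n * exp (s * \<bar>Y x\<bar>)" for x
    proof -
      have "\<bar>s * Y x\<bar> ^ n / fact n \<le> (\<Sum>i<Suc n. \<bar>s * Y x\<bar> ^ i / fact i)"
        by (simp add: sum_nonneg)
      also have "\<dots> \<le> exp (s * \<bar>Y x\<bar>)"
        using part[of "s * Y x" "Suc n"] s(1) by (simp add: abs_mult)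
      finally show ?thesis
        using s(1) by (simp add: abs_mult power_mult_distrib field_simps)
    qed
    then show "AE x in M. norm (Y x ^ n) \<le> norm (fact n / s ^ n * exp (s * \<bar>Y x\<bar>))"
      using s(1) by (simp add: power_abs)
  qed simp
  have "(\<lambda>n. expectation (\<lambda>x. \<Sum>i<n. (t * Y x) ^ i / fact i))
          \<longlonglongrightarrow> expectation (\<lambda>x. exp (t * Y x))"
  proof (rule integral_dominated_convergence[where w = "\<lambda>x. exp (\<bar>t\<bar> * \<bar>Y x\<bar>)"])
    show "integrable M (\<lambda>x. exp (\<bar>t\<bar> * \<bar>Y x\<bar>))"
      using int_abs[of "\<bar>t\<bar>"] t by simp
    show "AE x in M. (\<lambda>n. \<Sum>i<n. (t * Y x) ^ i / fact i) \<longlonglongrightarrow> exp (t * Y x)"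
    proof (rule AE_I2)
      fix x
      show "(\<lambda>n. \<Sum>i<n. (t * Y x) ^ i / fact i) \<longlonglongrightarrow> exp (t * Y x)"
        using exp_converges[of "t * Y x"]
        by (simp add: sums_def divide_inverse scaleR_conv_of_real mult.commute)
    qed
    show "AE x in M. norm (\<Sum>i<n. (t * Y x) ^ i / fact i) \<le> exp (\<bar>t\<bar> * \<bar>Y x\<bar>)" for n
    proof (rule AE_I2)
      fix x
      have "norm (\<Sum>i<n. (t * Y x) ^ i / fact i) \<le> (\<Sum>i<n. \<bar>t * Y x\<bar> ^ i / fact i)"
        by (rule order_trans[OF norm_sum]) (simp add: power_abs)
      then show "norm (\<Sum>i<n. (t * Y x) ^ i / fact i) \<le> exp (\<bar>t\<bar> * \<bar>Y x\<bar>)"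
        using part[of "t * Y x" n] by (simp add: abs_mult)
    qed
  qed simp_all
  moreover have "expectation (\<lambda>x. \<Sum>i<n. (t * Y x) ^ i / fact i)
      = (\<Sum>i<n. expectation (\<lambda>x. Y x ^ i) / fact i * t ^ i)" for n
    using moments by (simp add: power_mult_distrib field_simps)
  ultimately have "(\<lambda>i. expectation (\<lambda>x. Y x ^ i) / fact i * t ^ i)
      sums expectation (\<lambda>x. exp (t * Y x))"
    by (simp add: sums_def)
  moreover have "(\<lambda>i. (1 :: real fps) $ i * t ^ i) sums 1"
    using sums_single[of 0 "\<lambda>i. t ^ i"] by (simp add: if_distrib[of "\<lambda>c. c * _"] cong: if_cong)
  ultimately show ?thesis
    by (auto simp: egf_def left_diff_distrib dest: sums_diff)
qed

end

theory Submission
  imports Defs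
begin

text \<open>
  Everything rests on the compositional calculus of formal power series. For a series \<open>f\<close> without
  constant term, the array with entries \<open>n!/k! [t^n] f(t)^k\<close> describes, in the basis \<open>t^n/n!\<close>, the
  substitution \<open>h \<mapsto> h \<circ> f\<close>. Two successive substitutions are one substitution along the composite
  series, so multiplying two such arrays gives the array of the composite (\<open>sum_egf_array_mult\<close>).
  Both kinds of Stirling numbers are of this shape, for \<open>e\<^sub>Y\<close> and for its compositional inverse,
  which exists since \<open>E[Y] \<noteq> 0\<close>; hence their products in either order are the array of the identity
  series \<open>t\<close>, which is the Kronecker delta. This is part (a).

  Parts (b) and (c) are the linear algebra of two mutually inverse lower triangular matrices: (b)
  applies them to a column vector, while (c) applies the transposes of their top left blocks, which are
  again mutually inverse because the matrices are triangular. In both cases the proof substitutes one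
  relation into the other and interchanges the summations over a triangle of indices.
\<close>

text \<open>
  For \<open>f\<close> without constant term this is the iteration matrix of \<open>f\<close>, whose entries are the partial
  Bell polynomials in the numbers \<open>n! [t^n] f(t)\<close>.
\<close>

definition egf_array :: "'a::field_char_0 fps \<Rightarrow> nat \<Rightarrow> nat \<Rightarrow> 'a" where
  "egf_array f n k = fact n * ((fps_const (1 / fact k) * f ^ k) $ n)"

text \<open>
  The sum is the coefficient of \<open>t^n\<close> in \<open>g^l \<circ> f\<close>: the factorials \<open>k!\<close> cancel, and the terms with
  \<open>k < l\<close> vanish because \<open>g^l\<close> has no terms of degree below \<open>l\<close>. Substitution is multiplicative,
  so \<open>g^l \<circ> f = (g \<circ> f)^l\<close>.
\<close>

lemma sum_egf_array_mult:
  fixes f g :: "'a::field_char_0 fps"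
  assumes f: "f $ 0 = 0" and g: "g $ 0 = 0"
  shows "(\<Sum>k=l..n. egf_array f n k * egf_array g k l) = egf_array (g oo f) n l"
proof -
  have "(\<Sum>k=l..n. egf_array f n k * egf_array g k l)
      = fact n / fact l * (\<Sum>k=l..n. (g ^ l) $ k * (f ^ k) $ n)"
    unfolding sum_distrib_left by (rule sum.cong) (simp_all add: egf_array_def)
  also have "(\<Sum>k=l..n. (g ^ l) $ k * (f ^ k) $ n) = (\<Sum>k=0..n. (g ^ l) $ k * (f ^ k) $ n)"
    by (rule sum.mono_neutral_left) (use startsby_zero_power_prefix[OF g, of l] in auto)
  also have "\<dots> = ((g oo f) ^ l) $ n"
    by (simp add: fps_compose_nth fps_compose_power[OF f])
  finally show ?thesis
    by (simp add: egf_array_def)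
qed

lemma egf_array_X: "egf_array fps_X n k = (if n = k then 1 else 0)"
  by (simp add: egf_array_def fps_X_power_nth)

lemma sum_triangle_swap:
  fixes F :: "nat \<Rightarrow> nat \<Rightarrow> 'a::comm_monoid_add"
  shows "(\<Sum>k=p..n. \<Sum>l=p..k. F k l) = (\<Sum>l=p..n. \<Sum>k=l..n. F k l)"
  unfolding sum.Sigma[OF finite_atLeastAtMost ballI[OF finite_atLeastAtMost]]
  by (rule sum.reindex_bij_witness[of _ prod.swap prod.swap]) auto

text \<open>
  The identity \<open>A B = 1\<close> alone turns \<open>b = B a\<close> into \<open>a = A b\<close>. The converse implication is the same
  statement with the two matrices interchanged, and it uses \<open>B A = 1\<close>.
\<close>

lemma triangular_inversion:
  fixes A B :: "nat \<Rightarrow> nat \<Rightarrow> 'a::comm_ring_1"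
  assumes AB: "\<And>n l. (\<Sum>k=l..n. A n k * B k l) = (if n = l then 1 else 0)"
    and b: "\<And>n. b n = (\<Sum>k=0..n. B n k * a k)"
  shows "a n = (\<Sum>k=0..n. A n k * b k)"
proof -
  have "(\<Sum>k=0..n. A n k * b k) = (\<Sum>k=0..n. \<Sum>l=0..k. A n k * B k l * a l)"
    by (simp add: b sum_distrib_left mult.assoc)
  also have "\<dots> = (\<Sum>l=0..n. (\<Sum>k=l..n. A n k * B k l) * a l)"
    by (simp add: sum_triangle_swap sum_distrib_right)
  also have "\<dots> = (\<Sum>l=0..n. if l = n then a l else 0)"
    by (rule sum.cong) (simp_all add: AB)
  finally show ?thesis
    by simp
qed

text \<open>
  Transposition reverses products, so here it is \<open>B A = 1\<close> that leads from \<open>b\<close> back to \<open>a\<close>.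
\<close>

lemma triangular_inversion_transpose:
  fixes A B :: "nat \<Rightarrow> nat \<Rightarrow> 'a::comm_ring_1"
  assumes BA: "\<And>n l. (\<Sum>k=l..n. B n k * A k l) = (if n = l then 1 else 0)"
    and b: "\<And>n. n \<le> m \<Longrightarrow> b n = (\<Sum>k=n..m. B k n * a k)"
    and n: "n \<le> m"
  shows "a n = (\<Sum>k=n..m. A k n * b k)"
proof -
  have "(\<Sum>k=n..m. A k n * b k) = (\<Sum>k=n..m. \<Sum>j=k..m. B j k * A k n * a j)"
    by (rule sum.cong) (simp_all add: b sum_distrib_left mult_ac)
  also have "\<dots> = (\<Sum>j=n..m. (\<Sum>k=n..j. B j k * A k n) * a j)"
    by (simp add: sum_triangle_swap[symmetric] sum_distrib_right)
  also have "\<dots> = (\<Sum>j=n..m. if j = n then a j else 0)"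
    by (rule sum.cong) (simp_all add: BA)
  finally show ?thesis
    using n by simp
qed

theorem proposition1p1:
  fixes M :: "'a measure" and Y :: "'a \<Rightarrow> real"
  assumes "prob_space M"
    and "Y \<in> borel_measurable M"
    and "mgf_exists_near_0 M Y"
    and "integral\<^sup>L M Y \<noteq> 0"
  shows
    "(\<forall>n l :: nat.
        (\<Sum>k=l..n. stirling2_Y M Y n k * stirling1_Y M Y k l) = (if n = l then 1 else 0) \<and>
        (\<Sum>k=l..n. stirling1_Y M Y n k * stirling2_Y M Y k l) = (if n = l then 1 else 0)) \<and>
     (\<forall>a b :: nat \<Rightarrow> complex.
        (\<forall>n. a n = (\<Sum>k=0..n. of_real (stirling2_Y M Y n k) * b k)) \<longleftrightarrow>
        (\<forall>n. b n = (\<Sum>k=0..n. of_real (stirling1_Y M Y n k) * a k))) \<and>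
     (\<forall>(m :: nat) (a :: nat \<Rightarrow> complex) (b :: nat \<Rightarrow> complex).
        (\<forall>n\<le>m. a n = (\<Sum>k=n..m. of_real (stirling2_Y M Y k n) * b k)) \<longleftrightarrow>
        (\<forall>n\<le>m. b n = (\<Sum>k=n..m. of_real (stirling1_Y M Y k n) * a k)))"
proof -
  interpret prob_space M by fact
  let ?e = "egf M Y"
  let ?A = "\<lambda>n k. complex_of_real (stirling2_Y M Y n k)"
  let ?B = "\<lambda>n k. complex_of_real (stirling1_Y M Y n k)"
  have arrays: "stirling2_Y M Y = egf_array ?e" "stirling1_Y M Y = egf_array (fps_inv ?e)"
    by (simp_all add: fun_eq_iff stirling2_Y_def stirling1_Y_def egf_array_def)
  have inv_0: "fps_inv ?e $ 0 = 0"
    by (simp add: fps_inv_def)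
  have orth:
    "(\<Sum>k=l..n. stirling2_Y M Y n k * stirling1_Y M Y k l) = (if n = l then 1 else 0)"
    "(\<Sum>k=l..n. stirling1_Y M Y n k * stirling2_Y M Y k l) = (if n = l then 1 else 0)" for n l
    unfolding arrays
    by (simp_all add: sum_egf_array_mult egf_nth_0 inv_0 egf_array_X
        egf_compositional_inverse[OF assms(4)])
  \<comment> \<open>The sequences in (b) and (c) are complex, so the real identities are carried over.\<close>
  have AB: "(\<Sum>k=l..n. ?A n k * ?B k l) = (if n = l then 1 else 0)"
    and BA: "(\<Sum>k=l..n. ?B n k * ?A k l) = (if n = l then 1 else 0)" for n l
    using orth[of n l, THEN arg_cong[where f = complex_of_real]]
    by (simp_all add: if_distrib[of complex_of_real] cong: if_cong)
  have column: "(\<forall>n. a n = (\<Sum>k=0..n. ?A n k * b k)) \<longleftrightarrow> (\<forall>n. b n = (\<Sum>k=0..n. ?B n k * a k))"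
    for a b :: "nat \<Rightarrow> complex"
    using triangular_inversion[of ?A ?B b a, OF AB] triangular_inversion[of ?B ?A a b, OF BA]
    by blast
  have transposed: "(\<forall>n\<le>m. a n = (\<Sum>k=n..m. ?A k n * b k)) \<longleftrightarrow>
      (\<forall>n\<le>m. b n = (\<Sum>k=n..m. ?B k n * a k))" for m and a b :: "nat \<Rightarrow> complex"
    using triangular_inversion_transpose[of ?B ?A m b a, OF BA]
      triangular_inversion_transpose[of ?A ?B m a b, OF AB]
    by blast
  show ?thesis
    using orth column transposed by blast
qed

end
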